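(* Let $0<q<1$ and let $a,b$ satisfy $|a|,|b|<1$. Let $T_a$ be the linear transformation on polynomials in $x$ with $T_a(x^k)=(ae^{i\theta},ae^{-i\theta};q)_k$ for $k=0,1,2,\dots$, where $x=\cos\theta$. Then for every integer $n\ge0$ the Al-Salam--Chihara polynomials $p_n(x;a,b|q)$ and the little $q$-Laguerre polynomials $q_n(x;\cdot|q)$ are connected by $$p_n(x;a,b|q)=T_a\,q_n(x;ab/q|q).$$
   Context: Notation: $(z;q)_k=\prod_{j=0}^{k-1}(1-zq^j)$, $(z_1,\dots,z_m;q)_k=\prod_i(z_i;q)_k$. For $x=\cos\theta$, $(ae^{i\theta},ae^{-i\theta};q)_k=\prod_{j=0}^{k-1}(1+a^2q^{2j}-2aq^jx)$ is a polynomial in $x$. Al-Salam--Chihara polynomials: $$p_n(x;a,b|q)={}_3\phi_2\left(\left.\begin{array}{c}q^{-n},ae^{i\theta},ae^{-i\theta}\\ ab,0\end{array}\right|q,q\right)=\sum_{k=0}^n\frac{(q^{-n};q)_k(ae^{i\theta},ae^{-i\theta};q)_k}{(ab;q)_k(q;q)_k}q^k,\quad x=\cos\theta$$ (they are orthogonal on $[-1,1]$ with respect to $\frac{(e^{2i\theta},e^{-2i\theta};q)_\infty}{(ae^{i\theta},ae^{-i\theta},be^{i\theta},be^{-i\theta};q)_\infty}\frac{dx}{\sqrt{1-x^2}}$). Little $q$-Laguerre polynomials: $$q_n(x;a|q)={}_2\phi_1\left(\left.\begin{array}{c}q^{-n},0\\ aq\end{array}\right|q,qx\right)=\sum_{k=0}^n\frac{(q^{-n};q)_k}{(aq;q)_k(q;q)_k}(qx)^k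 .$$ *)

theory Defs
  imports Complex_Main "HOL-Computational_Algebra.Polynomial"
begin

definition qpoch :: "'a::comm_ring_1 \<Rightarrow> 'a \<Rightarrow> nat \<Rightarrow> 'a" where
  "qpoch z q k = (\<Prod>j<k. 1 - z * q ^ j)"

text \<open>
  Basic hypergeometric series with one more upper than lower parameter. Only this case is
  needed, so the factor \<open>((-1)\<^sup>k q\<^bsup>k(k-1)/2\<^esup>)\<^bsup>1+s-r\<^esup>\<close> of the general series is 1 and is omitted.
\<close>

definition basic_hyp :: "complex list \<Rightarrow> complex list \<Rightarrow> complex \<Rightarrow> complex \<Rightarrow> complex" where
  "basic_hyp as bs q z =
     (\<Sum>k. (\<Prod>c\<leftarrow>as. qpoch c q k) / ((\<Prod>c\<leftarrow>bs. qpoch c q k) * qpoch q q k) * z ^ k)"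

text \<open>
  The product \<open>(a e\<^bsup>i\<theta>\<^esup>, a e\<^bsup>-i\<theta>\<^esup>; q)\<^sub>k\<close> as a polynomial in \<open>x = cos \<theta>\<close>; see
  \<open>poly_asc_basis_cos\<close>.
\<close>

definition asc_basis :: "complex \<Rightarrow> complex \<Rightarrow> nat \<Rightarrow> complex poly" where
  "asc_basis a q k = (\<Prod>j<k. [: 1 + a\<^sup>2 * q ^ (2 * j), - 2 * a * q ^ j :])"

definition al_salam_chihara :: "nat \<Rightarrow> complex \<Rightarrow> complex \<Rightarrow> complex \<Rightarrow> complex poly" where
  "al_salam_chihara n a b q =
     (\<Sum>k\<le>n. smult (qpoch (q powi (- int n)) q k / (qpoch (a * b) q k * qpoch q q k) * q ^ k)
               (asc_basis a q k))"

definition little_q_laguerre :: "nat \<Rightarrow> complex \<Rightarrow> complex \<Rightarrow> complex poly" where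
  "little_q_laguerre n a q =
     (\<Sum>k\<le>n. smult (qpoch (q powi (- int n)) q k / (qpoch (a * q) q k * qpoch q q k))
               ([:0, q:] ^ k))"

text \<open>
  The linear transformation \<open>T\<^sub>a\<close> (depending also on \<open>q\<close>) with \<open>T\<^sub>a (x\<^sup>k) = asc_basis a q k\<close>.
  The lemmas \<open>asc_transform_add\<close>, \<open>asc_transform_smult\<close>, \<open>asc_transform_monom\<close> and
  \<open>asc_transform_unique\<close> show that it is the unique such map.
\<close>

definition asc_transform :: "complex \<Rightarrow> complex \<Rightarrow> complex poly \<Rightarrow> complex poly" where
  "asc_transform a q p = (\<Sum>k\<le>degree p. smult (coeff p k) (asc_basis a q k))"

lemma poly_asc_basis_cos:
  "poly (asc_basis a q k) (of_real (cos \<theta>)) = qpoch (a * cis \<theta>) q k * qpoch (a * cis (- \<theta>)) q k"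
proof -
  have c: "cis \<theta> * cis (-\<theta>) = 1"
    by (simp add: cis_mult)
  have s: "cis \<theta> + cis (-\<theta>) = 2 * of_real (cos \<theta>)"
    by (simp add: complex_eq_iff)
  have "1 + a\<^sup>2 * q ^ (2 * j) + of_real (cos \<theta>) * (- 2 * a * q ^ j)
      = (1 - a * cis \<theta> * q ^ j) * (1 - a * cis (-\<theta>) * q ^ j)" for j
  proof -
    have "(1 - a * cis \<theta> * q ^ j) * (1 - a * cis (-\<theta>) * q ^ j)
        = 1 - a * q ^ j * (cis \<theta> + cis (-\<theta>)) + a\<^sup>2 * (q ^ j)\<^sup>2 * (cis \<theta> * cis (-\<theta>))"
      by (simp add: algebra_simps power2_eq_square)
    also have "\<dots> = 1 + a\<^sup>2 * q ^ (2 * j) + of_real (cos \<theta>) * (- 2 * a * q ^ j)"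
      unfolding c s by (simp add: algebra_simps power_mult[symmetric] mult.commute[of 2 j])
    finally show ?thesis by simp
  qed
  then show ?thesis
    by (simp add: asc_basis_def qpoch_def poly_prod prod.distrib[symmetric])
qed

lemma qpoch_minus_eq_0:
  fixes q :: complex
  assumes "q \<noteq> 0" "n < k"
  shows "qpoch (q powi (- int n)) q k = 0"
proof -
  have "1 - q powi (- int n) * q ^ n = 0"
    using assms by (simp add: power_int_minus)
  then show ?thesis
    using assms unfolding qpoch_def by (intro prod_zero) auto
qed

lemma al_salam_chihara_basic_hyp:
  assumes "q \<noteq> 0"
  shows "poly (al_salam_chihara n a b q) (of_real (cos \<theta>)) =
    basic_hyp [q powi (- int n), a * cis \<theta>, a * cis (- \<theta>)] [a * b, 0] q q"
proof -
  have z: "qpoch 0 q k = 1" for k by (simp add: qpoch_def)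
  show ?thesis
    unfolding basic_hyp_def
    by (subst suminf_finite[of "{..n}"])
       (auto simp: z qpoch_minus_eq_0[OF assms] al_salam_chihara_def poly_sum poly_asc_basis_cos
             intro!: sum.cong)
qed

lemma little_q_laguerre_basic_hyp:
  assumes "q \<noteq> 0"
  shows "poly (little_q_laguerre n a q) x =
    basic_hyp [q powi (- int n), 0] [a * q] q (q * x)"
proof -
  have z: "qpoch 0 q k = 1" for k by (simp add: qpoch_def)
  show ?thesis
    unfolding basic_hyp_def
    by (subst suminf_finite[of "{..n}"])
       (auto simp: z qpoch_minus_eq_0[OF assms] little_q_laguerre_def poly_sum mult.commute
             intro!: sum.cong)
qed

lemma asc_transform_eq:
  assumes "degree p \<le> N"
  shows "asc_transform a q p = (\<Sum>k\<le>N. smult (coeff p k) (asc_basis a q k))"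
  unfolding asc_transform_def using assms
  by (intro sum.mono_neutral_left) (auto simp: coeff_eq_0)

lemma asc_transform_add: "asc_transform a q (p + r) = asc_transform a q p + asc_transform a q r"
proof -
  define N where "N = max (degree p) (degree r)"
  have "degree p \<le> N" "degree r \<le> N" "degree (p + r) \<le> N"
    unfolding N_def by (auto intro: degree_add_le_max)
  then show ?thesis
    by (simp add: asc_transform_eq smult_add_left sum.distrib)
qed

lemma asc_transform_smult: "asc_transform a q (smult c p) = smult c (asc_transform a q p)"
proof -
  have "asc_transform a q (smult c p)
      = (\<Sum>k\<le>degree p. smult (coeff (smult c p) k) (asc_basis a q k))"
    by (rule asc_transform_eq) (rule degree_smult_le)
  also have "\<dots> = smult c (asc_transform a q p)"
    unfolding asc_transform_def
    by (rule poly_eqI) (simp add: coeff_sum sum_distrib_left mult.assoc)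
  finally show ?thesis .
qed

lemma asc_transform_monom: "asc_transform a q (monom 1 k) = asc_basis a q k"
proof -
  have "asc_transform a q (monom 1 k) = (\<Sum>i\<le>k. smult (coeff (monom 1 k) i) (asc_basis a q i))"
    by (rule asc_transform_eq) (rule degree_monom_le)
  also have "\<dots> = (\<Sum>i\<le>k. if i = k then asc_basis a q k else 0)"
    by (intro sum.cong) auto
  finally show ?thesis by simp
qed

lemma asc_transform_unique:
  assumes add: "\<And>p r. T (p + r) = T p + T r"
    and smult: "\<And>c p. T (smult c p) = smult c (T p)"
    and monom: "\<And>k. T (monom 1 k) = asc_basis a q k"
  shows "T = asc_transform a q"
proof
  fix p
  have T0: "T 0 = 0" using smult[of 0 0] by simp
  have sum: "T (sum f A) = (\<Sum>i\<in>A. T (f i))" if "finite A" for f :: "nat \<Rightarrow> _" and A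
    using that by induction (auto simp: T0 add)
  have "T p = T (\<Sum>i\<le>degree p. smult (coeff p i) (monom 1 i))"
    by (simp add: smult_monom poly_as_sum_of_monoms)
  also have "\<dots> = asc_transform a q p"
    by (simp add: sum smult monom asc_transform_def)
  finally show "T p = asc_transform a q p" .
qed

end

theory Submission
  imports Defs
begin

text \<open>
  The two families have the same connection coefficients: with parameter \<open>ab/q\<close>, the little
  \<open>q\<close>-Laguerre denominator \<open>(aq; q)\<^sub>k\<close> becomes \<open>(ab; q)\<^sub>k\<close>, and the argument \<open>qx\<close> supplies the
  factor \<open>q\<^sup>k\<close> of the Al-Salam--Chihara series. Since \<open>T\<^sub>a\<close> is linear, it suffices to know its
  value at \<open>(qx)\<^sup>k\<close>.
\<close>

lemma asc_transform_sum:
  "asc_transform a q (\<Sum>i\<in>A. f i) = (\<Sum>i\<in>A. asc_transform a q (f i))"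
  by (induction A rule: infinite_finite_induct)
     (simp_all add: asc_transform_add asc_transform_def[of a q 0])

lemma asc_transform_linear_power:
  "asc_transform a q ([:0, c:] ^ k) = smult (c ^ k) (asc_basis a q k)"
proof -
  have "[:0, c:] ^ k = smult (c ^ k) (monom 1 k)"
    by (simp add: monom_altdef flip: smult_power)
  then show ?thesis
    by (simp add: asc_transform_smult asc_transform_monom)
qed

theorem theorem2p1:
  fixes q :: real and a b :: complex and n :: nat
  assumes "0 < q" and "q < 1" and "norm a < 1" and "norm b < 1"
  shows "al_salam_chihara n a b (of_real q) =
    asc_transform a (of_real q) (little_q_laguerre n (a * b / of_real q) (of_real q))"
  using \<open>0 < q\<close>
  by (simp add: al_salam_chihara_def little_q_laguerre_def asc_transform_sum
      asc_transform_smult asc_transform_linear_power)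

end
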